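(* Let $\gamma:I\to M$ be a unit speed curve in a spacelike hypersurface $M\subset\mathbb{R}^4_1$ such that $k_g(s)\neq0$, $(k_n\tau_2+k_g\tau_g)(s)\neq0$ and $k_n^2(s)>k_g^2(s)$ for any $s\in I$. Let $DS_\gamma(s,\theta(s))$, $s\in I$, be the singular points of the de Sitter surface $DS_\gamma$ of $\gamma$, where $\theta(s)$ is a smooth function with $$\tan\theta(s)=\frac{k_gk_n'+k_g^2\tau_1-k_n^2\tau_1-k_nk_g'}{\sqrt{k_n^2-k_g^2}\,(k_n\tau_2+k_g\tau_g)}(s).$$ Then the following conditions are equivalent: (1) $DS_\gamma(s,\theta(s))$ is a constant spacelike vector (independent of $s\in I$); (2) $\rho(s)=0$ for all $s\in I$; (3) there exist a spacelike vector $v$ and a real number $c$ such that $\gamma(I)\subset M\cap HP(v,c)$.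
   Context: $\mathbb{R}^4_1$ is $\mathbb{R}^4$ with $\langle x,y\rangle=-x_0y_0+x_1y_1+x_2y_2+x_3y_3$; a nonzero vector $x$ is spacelike, lightlike or timelike if $\langle x,x\rangle$ is $>0$, $=0$ or $<0$; $\|x\|=\sqrt{|\langle x,x\rangle|}$. With $\{e_0,e_1,e_2,e_3\}$ the canonical basis, $x\wedge y\wedge z$ is the formal determinant with rows $(-e_0,e_1,e_2,e_3),x,y,z$. For $v\ne0$ and $c\in\mathbb{R}$, $HP(v,c)=\{x\in\mathbb{R}^4_1\mid\langle x,v\rangle=c\}$. $S^3_1=\{x\in\mathbb{R}^4_1\mid\langle x,x\rangle=1\}$. $U\subset\mathbb{R}^3$ is open, $X:U\to\mathbb{R}^4_1$ is a smooth embedding all of whose nonzero tangent vectors are spacelike, $M=X(U)$ (a spacelike hypersurface), and $n$ is the unit timelike normal field along $M$ which is future directed ($\langle n,e_0\rangle<0$). $I$ is an open interval and $\gamma=X\circ\bar\gamma:I\to M$, with $\bar\gamma:I\to U$ a smooth regular curve, is parametrized by arc length ("unit speed"). Put $t=\gamma'$, $n_\gamma(s)=n(\gamma(s))$, $k_n=-\langle n_\gamma,t'\rangle$, $k_g=\|t'-k_nn_\gamma\|$ and, when $k_g\ne0$ (so $k_g>0$), $n_1=(t'-k_nn_\gamma)/k_g$, $n_2=n_\gamma\wedge t\wedge n_1$, $\tau_1=\langle n_1,n_\gamma'\rangle$, $\tau_2=\langle n_2,n_\gamma'\rangle$, $\tau_g=-\langle n_2',n_1\rangle$. Then $\{n_\gamma,t,n_1,n_2\}$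 is a pseudo-orthonormal frame along $\gamma$ with $n_\gamma'=k_nt+\tau_1n_1+\tau_2n_2$, $t'=k_nn_\gamma+k_gn_1$, $n_1'=\tau_1n_\gamma-k_gt+\tau_gn_2$, $n_2'=\tau_2n_\gamma-\tau_gn_1$. The de Sitter surface of $\gamma$ is (with $\theta$ read modulo $2\pi$) $$DS_\gamma(s,\theta)=\frac{\cos\theta}{\sqrt{k_n^2(s)-k_g^2(s)}}\bigl(k_g(s)n_\gamma(s)+k_n(s)n_1(s)\bigr)+\sin\theta\,n_2(s)\in S^3_1.$$ The invariant $\rho$ is $$\begin{aligned}\rho=\;&(-k_gk_n''-k_gk_n\tau_2^2-2k_gk_g'\tau_1-k_g^2\tau_1'-k_g^2\tau_g\tau_2+2k_nk_n'\tau_1+k_n^2\tau_1'-k_n^2\tau_g\tau_2+k_g''k_n-k_gk_n\tau_g^2)(k_n\tau_2+k_g\tau_g)\\&+(k_gk_n'+k_g^2\tau_1-k_n^2\tau_1-k_nk_g')(2k_n'\tau_2+k_n\tau_1\tau_g+k_n\tau_2'+2k_g'\tau_g+k_g\tau_1\tau_2+k_g\tau_g').\end{aligned}$$ *)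

theory Defs
  imports "HOL-Analysis.Analysis"
begin

text \<open>The index type \<open>4\<close> has the elements \<open>0, 1, 2, 3\<close>, so the coordinates of
  \<open>x :: real^4\<close> are \<open>x $ 0, \<dots>, x $ 3\<close> and the timelike one is \<open>x $ 0\<close>.\<close>

definition mink :: "real^4 \<Rightarrow> real^4 \<Rightarrow> real" where
  "mink x y = - (x $ 0 * y $ 0) + x $ 1 * y $ 1 + x $ 2 * y $ 2 + x $ 3 * y $ 3"

definition spacelike :: "real^4 \<Rightarrow> bool" where
  "spacelike x \<longleftrightarrow> x \<noteq> 0 \<and> mink x x > 0"

definition timelike :: "real^4 \<Rightarrow> bool" where
  "timelike x \<longleftrightarrow> x \<noteq> 0 \<and> mink x x < 0"

definition mnorm :: "real^4 \<Rightarrow> real" where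
  "mnorm x = sqrt \<bar>mink x x\<bar>"

text \<open>Formal determinant with rows \<open>(-e\<^sub>0, e\<^sub>1, e\<^sub>2, e\<^sub>3), x, y, z\<close>: it is linear in its
  first row, so its \<open>i\<close>-th coordinate is obtained by replacing that row by the \<open>i\<close>-th
  coordinates of its entries, i.e. by \<open>-e\<^sub>0\<close> if \<open>i = 0\<close> and by \<open>e\<^sub>i\<close> otherwise.\<close>

definition wedge :: "real^4 \<Rightarrow> real^4 \<Rightarrow> real^4 \<Rightarrow> real^4" where
  "wedge x y z = (\<chi> i. det (\<chi> r.
     if r = 0 then (if i = 0 then - axis 0 1 else axis i 1)
     else if r = 1 then x else if r = 2 then y else z))"

definition HP :: "real^4 \<Rightarrow> real \<Rightarrow> (real^4) set" where
  "HP v c = {x. mink x v = c}"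

text \<open>\<open>C\<^sup>k\<close> and \<open>C\<^sup>\<infinity>\<close> maps; meant for open \<open>S\<close>.\<close>

fun Ck_on :: "nat \<Rightarrow> 'a::real_normed_vector set \<Rightarrow> ('a \<Rightarrow> 'b::real_normed_vector) \<Rightarrow> bool" where
  "Ck_on 0 S f \<longleftrightarrow> continuous_on S f"
| "Ck_on (Suc k) S f \<longleftrightarrow> (\<forall>x\<in>S. f differentiable (at x)) \<and>
     (\<forall>h. Ck_on k S (\<lambda>x. frechet_derivative f (at x) h))"

definition smooth_on :: "'a::real_normed_vector set \<Rightarrow> ('a \<Rightarrow> 'b::real_normed_vector) \<Rightarrow> bool" where
  "smooth_on S f \<longleftrightarrow> (\<forall>k. Ck_on k S f)"

definition smooth_embedding :: "(real^3) set \<Rightarrow> (real^3 \<Rightarrow> real^4) \<Rightarrow> bool" where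
  "smooth_embedding U X \<longleftrightarrow> smooth_on U X \<and>
     (\<forall>u\<in>U. inj (frechet_derivative X (at u))) \<and>
     (\<exists>Y. homeomorphism U (X ` U) X Y)"

definition spacelike_embedding :: "(real^3) set \<Rightarrow> (real^3 \<Rightarrow> real^4) \<Rightarrow> bool" where
  "spacelike_embedding U X \<longleftrightarrow> open U \<and> smooth_embedding U X \<and>
     (\<forall>u\<in>U. \<forall>h. frechet_derivative X (at u) h \<noteq> 0 \<longrightarrow>
        spacelike (frechet_derivative X (at u) h))"

text \<open>These conditions determine \<open>n\<close> on \<open>X ` U\<close>; smoothness of a field along the
  embedded hypersurface is smoothness in the parameter.\<close>

definition future_unit_normal ::
    "(real^3) set \<Rightarrow> (real^3 \<Rightarrow> real^4) \<Rightarrow> (real^4 \<Rightarrow> real^4) \<Rightarrow> bool" where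
  "future_unit_normal U X n \<longleftrightarrow> smooth_on U (n \<circ> X) \<and>
     (\<forall>u\<in>U. timelike (n (X u)) \<and> mnorm (n (X u)) = 1 \<and>
        (\<forall>h. mink (n (X u)) (frechet_derivative X (at u) h) = 0) \<and>
        mink (n (X u)) (axis 0 1) < 0)"

definition regular_curve_on :: "real set \<Rightarrow> (real \<Rightarrow> real^3) \<Rightarrow> bool" where
  "regular_curve_on I g \<longleftrightarrow> smooth_on I g \<and> (\<forall>s\<in>I. vector_derivative g (at s) \<noteq> 0)"

definition unit_speed_on :: "real set \<Rightarrow> (real \<Rightarrow> real^4) \<Rightarrow> bool" where
  "unit_speed_on I \<gamma> \<longleftrightarrow> (\<forall>s\<in>I. mnorm (vector_derivative \<gamma> (at s)) = 1)"

definition n_curve :: "(real^4 \<Rightarrow> real^4) \<Rightarrow> (real \<Rightarrow> real^4) \<Rightarrow> real \<Rightarrow> real^4" where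
  "n_curve n \<gamma> s = n (\<gamma> s)"

definition tangent :: "(real \<Rightarrow> real^4) \<Rightarrow> real \<Rightarrow> real^4" where
  "tangent \<gamma> s = vector_derivative \<gamma> (at s)"

definition k_n :: "(real^4 \<Rightarrow> real^4) \<Rightarrow> (real \<Rightarrow> real^4) \<Rightarrow> real \<Rightarrow> real" where
  "k_n n \<gamma> s = - mink (n_curve n \<gamma> s) (vector_derivative (tangent \<gamma>) (at s))"

definition k_g :: "(real^4 \<Rightarrow> real^4) \<Rightarrow> (real \<Rightarrow> real^4) \<Rightarrow> real \<Rightarrow> real" where
  "k_g n \<gamma> s =
     mnorm (vector_derivative (tangent \<gamma>) (at s) - k_n n \<gamma> s *\<^sub>R n_curve n \<gamma> s)"

definition n1 :: "(real^4 \<Rightarrow> real^4) \<Rightarrow> (real \<Rightarrow> real^4) \<Rightarrow> real \<Rightarrow> real^4" where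
  "n1 n \<gamma> s = (1 / k_g n \<gamma> s) *\<^sub>R
     (vector_derivative (tangent \<gamma>) (at s) - k_n n \<gamma> s *\<^sub>R n_curve n \<gamma> s)"

definition n2 :: "(real^4 \<Rightarrow> real^4) \<Rightarrow> (real \<Rightarrow> real^4) \<Rightarrow> real \<Rightarrow> real^4" where
  "n2 n \<gamma> s = wedge (n_curve n \<gamma> s) (tangent \<gamma> s) (n1 n \<gamma> s)"

definition tau1 :: "(real^4 \<Rightarrow> real^4) \<Rightarrow> (real \<Rightarrow> real^4) \<Rightarrow> real \<Rightarrow> real" where
  "tau1 n \<gamma> s = mink (n1 n \<gamma> s) (vector_derivative (n_curve n \<gamma>) (at s))"

definition tau2 :: "(real^4 \<Rightarrow> real^4) \<Rightarrow> (real \<Rightarrow> real^4) \<Rightarrow> real \<Rightarrow> real" where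
  "tau2 n \<gamma> s = mink (n2 n \<gamma> s) (vector_derivative (n_curve n \<gamma>) (at s))"

definition tau_g :: "(real^4 \<Rightarrow> real^4) \<Rightarrow> (real \<Rightarrow> real^4) \<Rightarrow> real \<Rightarrow> real" where
  "tau_g n \<gamma> s = - mink (vector_derivative (n2 n \<gamma>) (at s)) (n1 n \<gamma> s)"

definition DS :: "(real^4 \<Rightarrow> real^4) \<Rightarrow> (real \<Rightarrow> real^4) \<Rightarrow> real \<Rightarrow> real \<Rightarrow> real^4" where
  "DS n \<gamma> s \<theta> =
     (cos \<theta> / sqrt ((k_n n \<gamma> s)\<^sup>2 - (k_g n \<gamma> s)\<^sup>2)) *\<^sub>R
       (k_g n \<gamma> s *\<^sub>R n_curve n \<gamma> s + k_n n \<gamma> s *\<^sub>R n1 n \<gamma> s)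
     + sin \<theta> *\<^sub>R n2 n \<gamma> s"

text \<open>Singular points of a parametrized surface: the differential is not injective, i.e.
  has rank less than \<open>2\<close>.\<close>

definition singular_at :: "(real \<Rightarrow> real \<Rightarrow> real^4) \<Rightarrow> real \<Rightarrow> real \<Rightarrow> bool" where
  "singular_at F s \<theta> \<longleftrightarrow>
     \<not> inj (frechet_derivative (\<lambda>p. F (fst p) (snd p)) (at (s, \<theta>)))"

definition rho :: "(real^4 \<Rightarrow> real^4) \<Rightarrow> (real \<Rightarrow> real^4) \<Rightarrow> real \<Rightarrow> real" where
  "rho n \<gamma> s =
    (let kn = k_n n \<gamma> s; kn' = deriv (k_n n \<gamma>) s; kn'' = deriv (deriv (k_n n \<gamma>)) s;
         kg = k_g n \<gamma> s; kg' = deriv (k_g n \<gamma>) s; kg'' = deriv (deriv (k_g n \<gamma>)) s;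
         t1 = tau1 n \<gamma> s; t1' = deriv (tau1 n \<gamma>) s;
         t2 = tau2 n \<gamma> s; t2' = deriv (tau2 n \<gamma>) s;
         tg = tau_g n \<gamma> s; tg' = deriv (tau_g n \<gamma>) s
     in (- kg * kn'' - kg * kn * t2\<^sup>2 - 2 * kg * kg' * t1 - kg\<^sup>2 * t1' - kg\<^sup>2 * tg * t2
         + 2 * kn * kn' * t1 + kn\<^sup>2 * t1' - kn\<^sup>2 * tg * t2 + kg'' * kn - kg * kn * tg\<^sup>2)
          * (kn * t2 + kg * tg)
        + (kg * kn' + kg\<^sup>2 * t1 - kn\<^sup>2 * t1 - kn * kg')
          * (2 * kn' * t2 + kn * t1 * tg + kn * t2' + 2 * kg' * tg + kg * t1 * t2 + kg * tg'))"

end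

theory Submission
  imports Defs
begin

text \<open>Write \<open>t\<close> for the unit tangent, \<open>n\<close> for the normal \<open>n\<^sub>\<gamma>\<close> along the curve, and put
\<open>B = k\<^sub>n \<tau>\<^sub>2 + k\<^sub>g \<tau>\<^sub>g\<close>, \<open>A = k\<^sub>g k\<^sub>n' + k\<^sub>g\<^sup>2 \<tau>\<^sub>1 - k\<^sub>n\<^sup>2 \<tau>\<^sub>1 - k\<^sub>n k\<^sub>g'\<close>, so that \<open>tan \<theta>\<close> is the quotient of \<open>A\<close> by
\<open>B sqrt (k\<^sub>n\<^sup>2 - k\<^sub>g\<^sup>2)\<close>. The proof rests on the single vector field
\<open>W = B k\<^sub>g n + B k\<^sub>n n\<^sub>1 + A n\<^sub>2\<close>:

\<^item> \<open>DS\<^sub>\<gamma>(s, \<theta>(s))\<close> is a nonzero multiple of \<open>W(s)\<close>, because the formula for \<open>tan \<theta>\<close> says exactly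
  that its coefficients are proportional to those of \<open>W\<close>.

\<^item> The vectors orthogonal to \<open>t\<close>, \<open>t'\<close> and \<open>t''\<close> are exactly the multiples of \<open>W\<close>
  (lemmas \<open>mink_W_T\<close> and \<open>perp_imp_multiple_W\<close>). Here \<open>B \<noteq> 0\<close> and \<open>k\<^sub>n \<noteq> 0\<close> make the three
  vectors linearly independent.

\<^item> \<open>\<rho> = \<langle>W, t'''\<rangle>\<close> (lemma \<open>mink_W_T'''\<close>), which explains the long formula for \<open>\<rho>\<close>: up to a
  factor it is the determinant of \<open>t, t', t'', t'''\<close>.

All implications now come from differentiating orthogonality relations. If \<open>DS\<^sub>\<gamma>(s, \<theta>(s))\<close> is a
constant \<open>v\<close>, then \<open>\<langle>\<gamma>, v\<rangle>' = \<langle>t, v\<rangle> = 0\<close>, so the curve lies in a hyperplane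
(\<open>constant_imp_hyperplane\<close>). If \<open>\<langle>\<gamma>, v\<rangle>\<close> is constant, then \<open>v\<close> is orthogonal to \<open>t, t', t'', t'''\<close>;
the first three make it a nonzero multiple of \<open>W\<close>, and the fourth gives \<open>\<rho> = 0\<close>
(\<open>hyperplane_imp_obstruction_zero\<close>). If \<open>\<rho> = 0\<close>, then \<open>D(s) = DS\<^sub>\<gamma>(s, \<theta>(s))\<close> is orthogonal to
\<open>t, t', t'', t'''\<close>, hence \<open>D'\<close> is orthogonal to \<open>t, t', t''\<close> and therefore a multiple of \<open>D\<close>; as
\<open>\<langle>D, D\<rangle> = 1\<close>, it is also orthogonal to \<open>D\<close>, so \<open>D' = 0\<close> (\<open>obstruction_zero_imp_constant\<close>).

These arguments use the structure equations of the frame \<open>n, t, n\<^sub>1, n\<^sub>2\<close> and the smoothness of the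
curvatures, which are derived from the smoothness of the embedding, the normal field and the curve
(\<open>darboux_frame_of_curve\<close>).\<close>


section \<open>Calculus of \<open>C\<^sup>k\<close> and smooth maps\<close>

lemma Ck_on_Suc_frechetI:
  assumes "\<And>x. x \<in> S \<Longrightarrow> (f has_derivative f' x) (at x)"
    and "\<And>h. Ck_on k S (\<lambda>x. frechet_derivative f (at x) h)"
  shows "Ck_on (Suc k) S f"
  using assms by (auto simp: differentiable_def)

lemma Ck_on_SucD:
  assumes "Ck_on (Suc k) S f"
  shows "x \<in> S \<Longrightarrow> (f has_derivative frechet_derivative f (at x)) (at x)"
    and "Ck_on k S (\<lambda>x. frechet_derivative f (at x) h)"
  using assms by (auto simp: frechet_derivative_works)

text \<open>By the recursive definition the claim for \<open>k + 1\<close> follows from that for \<open>k\<close> applied to the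
directional derivatives; only the base case, differentiable implies continuous, has content.\<close>

lemma Ck_on_lower: "Ck_on (Suc k) S f \<Longrightarrow> Ck_on k S f"
proof (induction k arbitrary: f)
  case 0
  then show ?case
    by (auto simp: differentiable_imp_continuous_within intro!: continuous_at_imp_continuous_on)
next
  case (Suc k)
  show ?case
    by (rule Ck_on_Suc_frechetI[OF Ck_on_SucD(1)[OF Suc.prems] Suc.IH[OF Ck_on_SucD(2)[OF Suc.prems]]])
qed

text \<open>Openness of \<open>S\<close> is what makes the two-sided derivatives at points of \<open>S\<close> depend only on the values
on \<open>S\<close>.\<close>

lemma Ck_on_cong:
  assumes "open S" "\<And>x. x \<in> S \<Longrightarrow> f x = g x" "Ck_on k S f"
  shows "Ck_on k S g"
  using assms(2,3)
proof (induction k arbitrary: f g)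
  case 0
  then show ?case by (simp cong: continuous_on_cong)
next
  case (Suc k)
  have d: "(g has_derivative frechet_derivative f (at x)) (at x)" if "x \<in> S" for x
    using Ck_on_SucD(1)[OF Suc.prems(2) that] has_derivative_transform_within_open[OF _ assms(1) that]
      Suc.prems(1) by blast
  have "Ck_on k S (\<lambda>x. frechet_derivative g (at x) h)" for h
    by (rule Suc.IH[OF _ Ck_on_SucD(2)[OF Suc.prems(2)]]) (simp add: frechet_derivative_at[OF d])
  with d show ?case by (rule Ck_on_Suc_frechetI)
qed

text \<open>This is the form of the induction step used below: it replaces \<open>frechet_derivative\<close> by whatever
derivative the usual rules compute.\<close>

lemma Ck_on_SucI:
  assumes "open S" and d: "\<And>x. x \<in> S \<Longrightarrow> (f has_derivative f' x) (at x)"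
    and "\<And>h. Ck_on k S (\<lambda>x. f' x h)"
  shows "Ck_on (Suc k) S f"
  by (rule Ck_on_Suc_frechetI[OF d]) 
     (auto intro!: Ck_on_cong[OF assms(1) _ assms(3)] simp: frechet_derivative_at[OF d, symmetric])

lemma Ck_on_const: "Ck_on k S (\<lambda>x. c)"
  by (induction k arbitrary: c) auto

lemma Ck_on_add:
  assumes "open S"
  shows "Ck_on k S f \<Longrightarrow> Ck_on k S g \<Longrightarrow> Ck_on k S (\<lambda>x. f x + g x)"
proof (induction k arbitrary: f g)
  case 0
  then show ?case by (auto intro: continuous_on_add)
next
  case (Suc k)
  show ?case
    by (rule Ck_on_SucI[OF assms])
      (auto intro!: has_derivative_add Suc.IH Ck_on_SucD[OF Suc.prems(1)] Ck_on_SucD[OF Suc.prems(2)])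
qed

lemma Ck_on_sum:
  assumes "open S" "finite B" "\<And>b. b \<in> B \<Longrightarrow> Ck_on k S (f b)"
  shows "Ck_on k S (\<lambda>x. \<Sum>b\<in>B. f b x)"
  using assms(2,3) by (induction B) (auto intro: Ck_on_add[OF assms(1)] Ck_on_const)

lemma Ck_on_linear:
  assumes "open S" "bounded_linear L"
  shows "Ck_on k S f \<Longrightarrow> Ck_on k S (\<lambda>x. L (f x))"
proof (induction k arbitrary: f)
  case 0
  then show ?case using assms(2) by (auto intro: bounded_linear.continuous_on)
next
  case (Suc k)
  show ?case
    by (rule Ck_on_SucI[OF assms(1)])
      (auto intro!: bounded_linear.has_derivative[OF assms(2)] Suc.IH Ck_on_SucD[OF Suc.prems(1)])
qed

text \<open>The Leibniz rule expresses the derivative of \<open>P (f x) (g x)\<close> through products of the same shape, one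
factor of which is only known to be \<open>C\<^sup>k\<close>; the other, being \<open>C\<^sup>k\<^sup>+\<^sup>1\<close>, is lowered to \<open>C\<^sup>k\<close>.\<close>

lemma Ck_on_bilinear:
  assumes "open S" "bounded_bilinear P"
  shows "Ck_on k S f \<Longrightarrow> Ck_on k S g \<Longrightarrow> Ck_on k S (\<lambda>x. P (f x) (g x))"
proof (induction k arbitrary: f g)
  case 0
  then show ?case using assms(2) by (auto intro: bounded_bilinear.continuous_on)
next
  case (Suc k)
  show ?case
    by (rule Ck_on_SucI[OF assms(1) bounded_bilinear.FDERIV[OF assms(2)
            Ck_on_SucD(1)[OF Suc.prems(1)] Ck_on_SucD(1)[OF Suc.prems(2)]]])
      (auto intro!: Ck_on_add[OF assms(1)] Suc.IH Ck_on_SucD(2)[OF Suc.prems(1)]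
        Ck_on_SucD(2)[OF Suc.prems(2)] Ck_on_lower[OF Suc.prems(1)] Ck_on_lower[OF Suc.prems(2)])
qed

text \<open>The direction \<open>Dg(x) h\<close> in the chain rule \<open>DF(g x) (Dg(x) h)\<close> moves with \<open>x\<close>, whereas \<open>Ck_on\<close> only
speaks about derivatives in a fixed direction. Expanding it in an orthonormal basis writes the derivative as a
finite sum of terms \<open>(Dg(x) h \<bullet> b) *\<^sub>R DF(g x) b\<close>, to which the induction hypothesis and the product
rule apply; this is why the middle space is Euclidean.\<close>

lemma Ck_on_compose:
  fixes g :: "'a::real_normed_vector \<Rightarrow> 'b::euclidean_space"
  assumes "open S" "g ` S \<subseteq> T"
  shows "Ck_on k T F \<Longrightarrow> Ck_on k S g \<Longrightarrow> Ck_on k S (\<lambda>x. F (g x))"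
proof (induction k arbitrary: F)
  case 0
  then show ?case using assms(2) by (auto intro: continuous_on_compose2)
next
  case (Suc k)
  let ?DF = "\<lambda>y. frechet_derivative F (at y)" and ?Dg = "\<lambda>x. frechet_derivative g (at x)"
  have d: "((\<lambda>x. F (g x)) has_derivative
      (\<lambda>h. \<Sum>b\<in>Basis. (?Dg x h \<bullet> b) *\<^sub>R ?DF (g x) b)) (at x)" if "x \<in> S" for x
  proof -
    have F: "(F has_derivative ?DF (g x)) (at (g x))"
      using Ck_on_SucD(1)[OF Suc.prems(1)] assms(2) that by blast
    have r: "?DF (g x) u = (\<Sum>b\<in>Basis. (u \<bullet> b) *\<^sub>R ?DF (g x) b)" for u
    proof -
      have "?DF (g x) (\<Sum>b\<in>Basis. (u \<bullet> b) *\<^sub>R b) = (\<Sum>b\<in>Basis. (u \<bullet> b) *\<^sub>R ?DF (g x) b)"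
        using has_derivative_linear[OF F] by (simp add: linear_sum linear_cmul)
      then show ?thesis by (simp add: euclidean_representation)
    qed
    show ?thesis
      by (rule has_derivative_eq_rhs[OF has_derivative_compose[OF Ck_on_SucD(1)[OF Suc.prems(2) that] F]])
        (rule ext, rule r)
  qed
  show ?case
    by (rule Ck_on_SucI[OF assms(1) d])
      (auto intro!: Ck_on_sum[OF assms(1)] Ck_on_bilinear[OF assms(1) bounded_bilinear_scaleR]
        Ck_on_linear[OF assms(1) bounded_linear_inner_left] Suc.IH
        Ck_on_SucD(2)[OF Suc.prems(1)] Ck_on_SucD(2)[OF Suc.prems(2)] Ck_on_lower[OF Suc.prems(2)])
qed

lemma smooth_on_const [simp]: "smooth_on S (\<lambda>x. c)"
  by (simp add: smooth_on_def Ck_on_const)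

lemma smooth_on_cong:
  assumes "open S" "\<And>x. x \<in> S \<Longrightarrow> f x = g x" "smooth_on S f"
  shows "smooth_on S g"
  using assms(3) by (auto simp: smooth_on_def intro: Ck_on_cong[OF assms(1,2)])

lemma smooth_on_linear:
  "open S \<Longrightarrow> bounded_linear L \<Longrightarrow> smooth_on S f \<Longrightarrow> smooth_on S (\<lambda>x. L (f x))"
  by (simp add: smooth_on_def Ck_on_linear)

lemma smooth_on_bilinear:
  "open S \<Longrightarrow> bounded_bilinear P \<Longrightarrow> smooth_on S f \<Longrightarrow> smooth_on S g \<Longrightarrow>
    smooth_on S (\<lambda>x. P (f x) (g x))"
  by (simp add: smooth_on_def Ck_on_bilinear)

lemma smooth_on_add:
  "open S \<Longrightarrow> smooth_on S f \<Longrightarrow> smooth_on S g \<Longrightarrow> smooth_on S (\<lambda>x. f x + g x)"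
  by (simp add: smooth_on_def Ck_on_add)

lemma smooth_on_sum:
  "open S \<Longrightarrow> finite B \<Longrightarrow> (\<And>b. b \<in> B \<Longrightarrow> smooth_on S (f b)) \<Longrightarrow> smooth_on S (\<lambda>x. \<Sum>b\<in>B. f b x)"
  by (simp add: smooth_on_def Ck_on_sum)

lemma smooth_on_uminus: "open S \<Longrightarrow> smooth_on S f \<Longrightarrow> smooth_on S (\<lambda>x. - f x)"
  by (rule smooth_on_linear[OF _ bounded_linear_minus[OF bounded_linear_ident]])

lemma smooth_on_diff:
  "open S \<Longrightarrow> smooth_on S f \<Longrightarrow> smooth_on S g \<Longrightarrow> smooth_on S (\<lambda>x. f x - g x)"
  using smooth_on_add[of S f "\<lambda>x. - g x"] smooth_on_uminus by auto

lemmas smooth_on_mult = smooth_on_bilinear[OF _ bounded_bilinear_mult]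
lemmas smooth_on_scaleR = smooth_on_bilinear[OF _ bounded_bilinear_scaleR]

lemma smooth_on_vec_nth: "open S \<Longrightarrow> smooth_on S f \<Longrightarrow> smooth_on S (\<lambda>x. f x $ i)"
  by (rule smooth_on_linear[OF _ bounded_linear_vec_nth])

lemma smooth_on_vec:
  fixes f :: "'a::real_normed_vector \<Rightarrow> real^'n"
  assumes "open S" "\<And>i. smooth_on S (\<lambda>x. f x $ i)"
  shows "smooth_on S f"
proof -
  have "smooth_on S (\<lambda>x. \<Sum>i\<in>UNIV. f x $ i *\<^sub>R axis i (1::real))"
    by (intro smooth_on_sum smooth_on_scaleR assms) auto
  moreover have "(\<lambda>x. \<Sum>i\<in>UNIV. f x $ i *\<^sub>R axis i 1) = f"
    by (rule ext) (simp flip: scalar_mult_eq_scaleR add: basis_expansion)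
  ultimately show ?thesis by (simp only:)
qed

lemma smooth_on_compose:
  fixes g :: "'a::real_normed_vector \<Rightarrow> 'b::euclidean_space"
  shows "open S \<Longrightarrow> g ` S \<subseteq> T \<Longrightarrow> smooth_on T F \<Longrightarrow> smooth_on S g \<Longrightarrow> smooth_on S (\<lambda>x. F (g x))"
  by (simp add: smooth_on_def Ck_on_compose)

lemma smooth_on_imp_has_vector_derivative:
  fixes f :: "real \<Rightarrow> 'b::real_normed_vector"
  assumes "smooth_on S f" "s \<in> S"
  shows "(f has_vector_derivative vector_derivative f (at s)) (at s)"
proof -
  have "Ck_on (Suc 0) S f" using assms(1) unfolding smooth_on_def by blast
  with assms(2) show ?thesis
    by (simp add: vector_derivative_works)
qed

lemma smooth_on_vector_derivative:
  assumes "open S" "smooth_on S f"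
  shows "smooth_on S (\<lambda>s. vector_derivative f (at s))"
  unfolding smooth_on_def
proof
  fix k
  have c: "Ck_on (Suc k) S f" using assms(2) unfolding smooth_on_def by blast
  show "Ck_on k S (\<lambda>s. vector_derivative f (at s))"
  proof (rule Ck_on_cong[OF assms(1) _ Ck_on_SucD(2)[OF c, of 1]])
    fix s assume "s \<in> S"
    then have "(f has_derivative (\<lambda>h. h *\<^sub>R vector_derivative f (at s))) (at s)"
      using smooth_on_imp_has_vector_derivative[OF assms(2)]
      by (simp add: has_vector_derivative_def)
    from frechet_derivative_at[OF this]
    show "frechet_derivative f (at s) 1 = vector_derivative f (at s)" by (metis scaleR_one)
  qed
qed

lemma smooth_on_imp_DERIV:
  fixes f :: "real \<Rightarrow> real"
  assumes "smooth_on S f" "s \<in> S"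
  shows "(f has_real_derivative deriv f s) (at s)"
  using smooth_on_imp_has_vector_derivative[OF assms]
  by (metis DERIV_imp_deriv has_real_derivative_iff_has_vector_derivative)

lemma smooth_on_deriv:
  fixes f :: "real \<Rightarrow> real"
  assumes "open S" "smooth_on S f"
  shows "smooth_on S (deriv f)"
proof (rule smooth_on_cong[OF assms(1) _ smooth_on_vector_derivative[OF assms]])
  fix s assume "s \<in> S"
  from smooth_on_imp_DERIV[OF assms(2) this] show "vector_derivative f (at s) = deriv f s"
    by (simp add: has_real_derivative_iff_has_vector_derivative vector_derivative_at)
qed

text \<open>Both this lemma and the next are inductions on a differential equation: the derivative of the function is
built from functions already known to be \<open>C\<^sup>k\<close>.\<close>

lemma Ck_on_inverse: "Ck_on k {0<..} (inverse :: real \<Rightarrow> real)"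
proof (induction k)
  case 0
  then show ?case by (auto intro!: continuous_intros)
next
  case (Suc k)
  show ?case
    by (rule Ck_on_SucI[of _ _ "\<lambda>x h. - (inverse x * h * inverse x)"])
      (auto intro!: has_derivative_inverse' Ck_on_linear[OF _ bounded_linear_minus[OF bounded_linear_ident]]
        Ck_on_bilinear[OF _ bounded_bilinear_mult] Suc.IH Ck_on_const)
qed

lemma Ck_on_sqrt: "Ck_on k {0<..} sqrt"
proof (induction k)
  case 0
  then show ?case by (auto intro!: continuous_intros)
next
  case (Suc k)
  show ?case
  proof (rule Ck_on_SucI[of _ _ "\<lambda>x h. inverse (sqrt x) * (h / 2)"])
    show "(sqrt has_derivative (\<lambda>h. inverse (sqrt x) * (h / 2))) (at x)" if "x \<in> {0<..}" for x
      using DERIV_real_sqrt[of x] that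
      by (auto simp: has_field_derivative_def field_simps elim!: has_derivative_eq_rhs)
    show "Ck_on k {0<..} (\<lambda>x. inverse (sqrt x) * (h / 2))" for h
      by (intro Ck_on_bilinear[OF _ bounded_bilinear_mult] Ck_on_const
         Ck_on_compose[OF _ _ Ck_on_inverse Suc.IH]) auto
  qed auto
qed

lemma smooth_on_sqrt:
  "open S \<Longrightarrow> (\<And>x. x \<in> S \<Longrightarrow> f x > 0) \<Longrightarrow> smooth_on S f \<Longrightarrow> smooth_on S (\<lambda>x. sqrt (f x))"
  by (rule smooth_on_compose[where T = "{0<..}"]) (auto simp: smooth_on_def Ck_on_sqrt)

lemma smooth_on_inverse:
  fixes f :: "'a::real_normed_vector \<Rightarrow> real"
  shows "open S \<Longrightarrow> (\<And>x. x \<in> S \<Longrightarrow> f x > 0) \<Longrightarrow> smooth_on S f \<Longrightarrow> smooth_on S (\<lambda>x. inverse (f x))"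
  by (rule smooth_on_compose[where T = "{0<..}"]) (auto simp: smooth_on_def Ck_on_inverse)

section \<open>Minkowski space\<close>

text \<open>This links the timelike index \<open>0\<close> to the enumeration \<open>1, 2, 3, 4\<close> of the indices in \<open>forall_4\<close>.\<close>

lemma zero_4: "(4::4) = 0"
  by simp

lemma bounded_bilinear_mink: "bounded_bilinear mink"
  unfolding bilinear_conv_bounded_bilinear[symmetric] bilinear_def
  by (auto intro!: linearI simp: mink_def algebra_simps)

interpretation mink: bounded_bilinear mink
  by (rule bounded_bilinear_mink)

lemma mink_commute: "mink x y = mink y x"
  by (simp add: mink_def mult.commute)

text \<open>The spatial Cauchy-Schwarz inequality: if \<open>\<bar>b\<^sub>0\<bar>\<close> exceeded the length of the spatial part of \<open>b\<close>,
then \<open>a\<^sub>0\<^sup>2 b\<^sub>0\<^sup>2\<close> would exceed the product of the squared spatial lengths, hence the square of the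
spatial inner product.\<close>

lemma perp_time_vector_coordinates:
  fixes a0 a1 a2 a3 b0 b1 b2 b3 :: real
  assumes "a0^2 > a1^2+a2^2+a3^2" and "a0*b0 = a1*b1+a2*b2+a3*b3"
  shows "b0^2 \<le> b1^2+b2^2+b3^2"
proof (rule ccontr)
  assume "\<not> ?thesis"
  then have b: "b1^2+b2^2+b3^2 < b0^2" by simp
  have "(a1*b1+a2*b2+a3*b3)^2 \<le> (a1^2+a2^2+a3^2) * (b1^2+b2^2+b3^2)"
    using sum_squares_ge_zero[of "a1*b2-a2*b1" "a1*b3-a3*b1"] zero_le_square[of "a2*b3-a3*b2"]
    by (simp add: power2_eq_square algebra_simps)
  also have "\<dots> \<le> a0^2 * (b1^2+b2^2+b3^2)"
    using assms(1) by (intro mult_right_mono) auto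
  also have "\<dots> < a0^2 * b0^2"
    using b le_less_trans[OF _ assms(1), of 0] by (intro mult_strict_left_mono) auto
  finally show False using assms(2) by (metis less_irrefl power_mult_distrib)
qed

lemma mink_perp_timelike_nonneg:
  assumes "mink x x < 0" "mink x y = 0"
  shows "mink y y \<ge> 0"
  using perp_time_vector_coordinates[of "x$1" "x$2" "x$3" "x$0" "y$0" "y$1" "y$2" "y$3"] assms
  by (simp add: mink_def power2_eq_square)

definition pseudo_orthonormal :: "real^4 \<Rightarrow> real^4 \<Rightarrow> real^4 \<Rightarrow> real^4 \<Rightarrow> bool" where
  "pseudo_orthonormal a b c d \<longleftrightarrow>
     mink a a = -1 \<and> mink b b = 1 \<and> mink c c = 1 \<and> mink d d = 1 \<and>
     mink a b = 0 \<and> mink a c = 0 \<and> mink a d = 0 \<and> mink b c = 0 \<and> mink b d = 0 \<and> mink c d = 0"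

text \<open>Pairing a linear combination with the four vectors recovers its coefficients, up to the sign of the
timelike one. So \<open>L\<close> is injective on a four-dimensional space, hence onto, and every vector is such a
combination.\<close>

lemma pseudo_orthonormal_expand:
  assumes "pseudo_orthonormal a b c d"
  shows "x = - mink x a *\<^sub>R a + mink x b *\<^sub>R b + mink x c *\<^sub>R c + mink x d *\<^sub>R d"
proof -
  define L :: "real^4 \<Rightarrow> real^4"
    where "L y = (y$0) *\<^sub>R a + (y$1) *\<^sub>R b + (y$2) *\<^sub>R c + (y$3) *\<^sub>R d" for y
  have M: "mink (L y) a = - y$0" "mink (L y) b = y$1" "mink (L y) c = y$2" "mink (L y) d = y$3" for y
    using assms mink_commute[of b a] mink_commute[of c a] mink_commute[of d a]
      mink_commute[of c b] mink_commute[of d b] mink_commute[of d c]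
    by (simp_all add: L_def pseudo_orthonormal_def mink.add_left mink.scaleR_left)
  have "linear L"
    by (rule linearI) (simp_all add: L_def algebra_simps)
  moreover have "inj L"
  proof (rule injI)
    fix y z assume "L y = L z"
    with M[of y] M[of z] have "y$0 = z$0" "y$1 = z$1" "y$2 = z$2" "y$3 = z$3" by auto
    then show "y = z" 
      unfolding vec_eq_iff forall_4 zero_4 by blast
  qed
  ultimately have "surj L" by (rule linear_inj_imp_surj)
  then obtain y where "x = L y" by blast
  with M[of y] show ?thesis by (simp add: L_def)
qed

lemma det_4:
  fixes A :: "real^4^4" shows "det A =
  A$0$0 * (A$1$1*(A$2$2*A$3$3-A$2$3*A$3$2) - A$1$2*(A$2$1*A$3$3-A$2$3*A$3$1) + A$1$3*(A$2$1*A$3$2-A$2$2*A$3$1))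
 -A$0$1 * (A$1$0*(A$2$2*A$3$3-A$2$3*A$3$2) - A$1$2*(A$2$0*A$3$3-A$2$3*A$3$0) + A$1$3*(A$2$0*A$3$2-A$2$2*A$3$0))
 +A$0$2 * (A$1$0*(A$2$1*A$3$3-A$2$3*A$3$1) - A$1$1*(A$2$0*A$3$3-A$2$3*A$3$0) + A$1$3*(A$2$0*A$3$1-A$2$1*A$3$0))
 -A$0$3 * (A$1$0*(A$2$1*A$3$2-A$2$2*A$3$1) - A$1$1*(A$2$0*A$3$2-A$2$2*A$3$0) + A$1$2*(A$2$0*A$3$1-A$2$1*A$3$0))"
proof -
  have U: "(UNIV::4 set) = {0,1,2,3}" using UNIV_4 by auto
  have f: "finite {1::4,2,3}" "0 \<notin> {1::4,2,3}" "finite {2::4,3}" "1 \<notin> {2::4,3}" "finite {3::4}" "2 \<notin> {3::4}"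
    by auto
  show ?thesis
    unfolding det_def U
    unfolding sum_over_permutations_insert[OF f(1,2)] sum_over_permutations_insert[OF f(3,4)]
      sum_over_permutations_insert[OF f(5,6)] permutes_sing
    by (simp add: sign_swap_id permutation_swap_id sign_compose permutation_compose algebra_simps)
qed

lemma wedge_nth:
  "wedge x y z $ 0 = - (x$1*(y$2*z$3-y$3*z$2) - x$2*(y$1*z$3-y$3*z$1) + x$3*(y$1*z$2-y$2*z$1))"
  "wedge x y z $ 1 = - (x$0*(y$2*z$3-y$3*z$2) - x$2*(y$0*z$3-y$3*z$0) + x$3*(y$0*z$2-y$2*z$0))"
  "wedge x y z $ 2 = x$0*(y$1*z$3-y$3*z$1) - x$1*(y$0*z$3-y$3*z$0) + x$3*(y$0*z$1-y$1*z$0)"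
  "wedge x y z $ 3 = - (x$0*(y$1*z$2-y$2*z$1) - x$1*(y$0*z$2-y$2*z$0) + x$2*(y$0*z$1-y$1*z$0))"
  by (simp_all add: wedge_def det_4 axis_def)

lemma mink_wedge:
  "mink x (wedge x y z) = 0" "mink y (wedge x y z) = 0" "mink z (wedge x y z) = 0"
  by (simp_all add: mink_def wedge_nth algebra_simps)

text \<open>The Lorentzian Lagrange identity: up to sign, the Gram determinant of the three factors.\<close>

lemma mink_wedge_wedge:
  "mink (wedge x y z) (wedge x y z) = 
    - (mink x x * (mink y y * mink z z - mink y z * mink y z)
       - mink x y * (mink x y * mink z z - mink y z * mink x z)
       + mink x z * (mink x y * mink y z - mink y y * mink x z))"
  unfolding mink_def wedge_nth by algebra

lemma pseudo_orthonormal_wedge: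
  assumes "mink a a = -1" "mink b b = 1" "mink c c = 1" "mink a b = 0" "mink a c = 0" "mink b c = 0"
  shows "pseudo_orthonormal a b c (wedge a b c)"
  using assms by (simp add: pseudo_orthonormal_def mink_wedge mink_wedge_wedge)

lemma smooth_on_wedge:
  assumes "open S" "smooth_on S f" "smooth_on S g" "smooth_on S h"
  shows "smooth_on S (\<lambda>x. wedge (f x) (g x) (h x))"
proof (rule smooth_on_vec[OF assms(1)])
  have "\<forall>i::4. smooth_on S (\<lambda>x. wedge (f x) (g x) (h x) $ i)"
    unfolding forall_4 zero_4 wedge_nth
    by (intro conjI smooth_on_uminus smooth_on_add smooth_on_diff smooth_on_mult smooth_on_vec_nth assms)
  then show "smooth_on S (\<lambda>x. wedge (f x) (g x) (h x) $ i)" for i by blast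
qed

lemma smooth_on_mink:
  "open S \<Longrightarrow> smooth_on S f \<Longrightarrow> smooth_on S g \<Longrightarrow> smooth_on S (\<lambda>x. mink (f x) (g x))"
  by (rule smooth_on_bilinear[OF _ bounded_bilinear_mink])

section \<open>Curves with a moving frame\<close>

lemma mink_const_imp_deriv_zero:
  assumes "open I" "s \<in> I" "\<And>s. s \<in> I \<Longrightarrow> mink (f s) (g s) = c"
    and "(f has_vector_derivative f') (at s)" "(g has_vector_derivative g') (at s)"
  shows "mink f' (g s) + mink (f s) g' = 0"
proof -
  have "((\<lambda>s. mink (f s) (g s)) has_vector_derivative mink (f s) g' + mink f' (g s)) (at s)"
    using assms(4,5) by (rule mink.has_vector_derivative)
  moreover have "((\<lambda>s. mink (f s) (g s)) has_vector_derivative 0) (at s)"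
    by (rule has_vector_derivative_transform_within_open[of "\<lambda>_. c" _ _ I]) (use assms(1-3) in auto)
  ultimately show ?thesis using vector_derivative_unique_at by (metis add.commute)
qed

lemma pseudo_orthonormal_mink:
  assumes "pseudo_orthonormal a b c d"
  shows "mink a a = -1" "mink b b = 1" "mink c c = 1" "mink d d = 1"
    "mink a b = 0" "mink a c = 0" "mink a d = 0" "mink b c = 0" "mink b d = 0" "mink c d = 0"
    "mink b a = 0" "mink c a = 0" "mink d a = 0" "mink c b = 0" "mink d b = 0" "mink d c = 0"
  using assms by (auto simp: pseudo_orthonormal_def mink_commute)

text \<open>The structure equations are all that the equivalence needs to know about the geometry: the
hypersurface no longer occurs here.\<close>

locale darboux_frame =
  fixes I :: "real set" and N T E1 E2 :: "real \<Rightarrow> real^4" and kn kg t1 t2 tg :: "real \<Rightarrow> real"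
  assumes open_I: "open I"
    and frame: "s \<in> I \<Longrightarrow> pseudo_orthonormal (N s) (T s) (E1 s) (E2 s)"
    and N_deriv: "s \<in> I \<Longrightarrow>
      (N has_vector_derivative kn s *\<^sub>R T s + t1 s *\<^sub>R E1 s + t2 s *\<^sub>R E2 s) (at s)"
    and T_deriv: "s \<in> I \<Longrightarrow> (T has_vector_derivative kn s *\<^sub>R N s + kg s *\<^sub>R E1 s) (at s)"
    and E1_deriv: "s \<in> I \<Longrightarrow>
      (E1 has_vector_derivative t1 s *\<^sub>R N s - kg s *\<^sub>R T s + tg s *\<^sub>R E2 s) (at s)"
    and E2_deriv: "s \<in> I \<Longrightarrow> (E2 has_vector_derivative t2 s *\<^sub>R N s - tg s *\<^sub>R E1 s) (at s)"
    and smooth: "smooth_on I kn" "smooth_on I kg" "smooth_on I t1" "smooth_on I t2" "smooth_on I tg"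
    and kn_kg: "s \<in> I \<Longrightarrow> (kn s)\<^sup>2 > (kg s)\<^sup>2"
    and nondegenerate: "s \<in> I \<Longrightarrow> kn s * t2 s + kg s * tg s \<noteq> 0"
begin

text \<open>The vectors \<open>kg N + kn E1\<close> and \<open>E2\<close> span the orthogonal complement of \<open>T\<close> and \<open>T' = kn N + kg E1\<close>;
\<open>- A\<close> and \<open>B\<close> are their products with \<open>T''\<close>.\<close>

definition A where "A s = kg s * deriv kn s + (kg s)\<^sup>2 * t1 s - (kn s)\<^sup>2 * t1 s - kn s * deriv kg s"
definition B where "B s = kn s * t2 s + kg s * tg s"

text \<open>The normal direction of the hyperplane spanned by \<open>T\<close>, \<open>T'\<close>, \<open>T''\<close>, scaled so that no division occurs.\<close>

definition W where "W s = (B s * kg s) *\<^sub>R N s + (B s * kn s) *\<^sub>R E1 s + A s *\<^sub>R E2 s"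

text \<open>The derivatives of \<open>T\<close>, written in the frame by means of the structure equations.\<close>

definition T' where "T' s = kn s *\<^sub>R N s + kg s *\<^sub>R E1 s"
definition T'' where
  "T'' s = (deriv kn s + kg s * t1 s) *\<^sub>R N s + ((kn s)\<^sup>2 - (kg s)\<^sup>2) *\<^sub>R T s
     + (kn s * t1 s + deriv kg s) *\<^sub>R E1 s + B s *\<^sub>R E2 s"
definition T''' where
  "T''' s =
     (deriv (deriv kn) s + deriv kg s * t1 s + kg s * deriv t1 s + ((kn s)\<^sup>2 - (kg s)\<^sup>2) * kn s
        + (kn s * t1 s + deriv kg s) * t1 s + B s * t2 s) *\<^sub>R N s
   + (2 * kn s * deriv kn s - 2 * kg s * deriv kg s + (deriv kn s + kg s * t1 s) * kn s
        - (kn s * t1 s + deriv kg s) * kg s) *\<^sub>R T s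
   + (deriv kn s * t1 s + kn s * deriv t1 s + deriv (deriv kg) s + (deriv kn s + kg s * t1 s) * t1 s
        + ((kn s)\<^sup>2 - (kg s)\<^sup>2) * kg s - B s * tg s) *\<^sub>R E1 s
   + (deriv kn s * t2 s + kn s * deriv t2 s + deriv kg s * tg s + kg s * deriv tg s
        + (deriv kn s + kg s * t1 s) * t2 s + (kn s * t1 s + deriv kg s) * tg s) *\<^sub>R E2 s"

text \<open>The invariant \<open>\<rho>\<close> as a function of the curvatures of the frame.\<close>

definition obstruction where
  "obstruction s =
    (- kg s * deriv (deriv kn) s - kg s * kn s * (t2 s)\<^sup>2 - 2 * kg s * deriv kg s * t1 s
       - (kg s)\<^sup>2 * deriv t1 s - (kg s)\<^sup>2 * tg s * t2 s + 2 * kn s * deriv kn s * t1 s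
       + (kn s)\<^sup>2 * deriv t1 s - (kn s)\<^sup>2 * tg s * t2 s + deriv (deriv kg) s * kn s
       - kg s * kn s * (tg s)\<^sup>2) * (kn s * t2 s + kg s * tg s)
   + (kg s * deriv kn s + (kg s)\<^sup>2 * t1 s - (kn s)\<^sup>2 * t1 s - kn s * deriv kg s)
       * (2 * deriv kn s * t2 s + kn s * t1 s * tg s + kn s * deriv t2 s + 2 * deriv kg s * tg s
          + kg s * t1 s * t2 s + kg s * deriv tg s)"

lemmas frame_mink = pseudo_orthonormal_mink[OF frame]
lemmas mink_expand = mink.add_left mink.add_right mink.scaleR_left mink.scaleR_right
  mink.diff_left mink.diff_right

lemmas scalar_deriv = smooth[THEN smooth_on_imp_DERIV]
  smooth_on_imp_DERIV[OF smooth_on_deriv[OF open_I smooth(1)]]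
  smooth_on_imp_DERIV[OF smooth_on_deriv[OF open_I smooth(2)]]

lemma T_deriv': "s \<in> I \<Longrightarrow> (T has_vector_derivative T' s) (at s)"
  using T_deriv by (simp add: T'_def)

lemma T'_deriv: "s \<in> I \<Longrightarrow> (T' has_vector_derivative T'' s) (at s)"
  unfolding T'_def T''_def B_def
  by (rule has_vector_derivative_eq_rhs, (rule derivative_intros scalar_deriv N_deriv E1_deriv | assumption)+)
    (simp add: algebra_simps power2_eq_square)

lemma T''_deriv: "s \<in> I \<Longrightarrow> (T'' has_vector_derivative T''' s) (at s)"
  unfolding T''_def T'''_def B_def
  by (rule has_vector_derivative_eq_rhs, (rule derivative_eq_intros scalar_deriv N_deriv T_deriv E1_deriv E2_deriv refl | assumption)+)
    (simp add: vec_eq_iff algebra_simps power2_eq_square)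

lemma mink_W_T:
  assumes "s \<in> I"
  shows "mink (W s) (T s) = 0" "mink (W s) (T' s) = 0" "mink (W s) (T'' s) = 0"
  using frame_mink[OF assms]
  by (simp_all add: W_def T'_def T''_def A_def mink_expand algebra_simps power2_eq_square)

text \<open>The first bracket in \<open>\<rho>\<close> is the product of \<open>T'''\<close> with \<open>kg N + kn E1\<close>, the last its
product with \<open>E2\<close>; they are weighted by the coefficients \<open>B\<close> and \<open>A\<close> of \<open>W\<close>.\<close>

lemma mink_W_T''':
  assumes "s \<in> I"
  shows "mink (W s) (T''' s) = obstruction s"
  using frame_mink[OF assms]
  by (simp add: W_def T'''_def A_def B_def obstruction_def mink_expand algebra_simps power2_eq_square)

text \<open>Orthogonality to \<open>T'\<close> forces the \<open>N\<close>- and \<open>E1\<close>-components of \<open>x\<close> to be proportional to \<open>kg\<close> and \<open>kn\<close>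
(solvable since \<open>kn \<noteq> 0\<close>), and orthogonality to \<open>T''\<close> then determines the \<open>E2\<close>-component, since
\<open>B \<noteq> 0\<close>.\<close>

lemma perp_imp_multiple_W:
  assumes s: "s \<in> I" and "mink x (T s) = 0" "mink x (T' s) = 0" "mink x (T'' s) = 0"
  obtains c where "x = c *\<^sub>R W s"
proof -
  define p q u where pqu: "p = mink x (N s)" "q = mink x (E1 s)" "u = mink x (E2 s)"
  have kn0: "kn s \<noteq> 0" using kn_kg[OF s] by (metis less_irrefl not_less zero_le_power2 zero_power2)
  have B0: "B s \<noteq> 0" using nondegenerate[OF s] by (simp add: B_def)
  define l where "l = q / kn s"
  have q: "q = l * kn s" using kn0 by (simp add: l_def)
  have "kn s * p + kg s * q = 0" using assms(3) by (simp add: T'_def mink_expand pqu)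
  then have "kn s * (p + l * kg s) = 0" by (simp add: q algebra_simps)
  with kn0 have p: "p = - l * kg s" by simp
  have "(deriv kn s + kg s * t1 s) * p + (kn s * t1 s + deriv kg s) * q + B s * u = 0"
    using assms(2,4) by (simp add: T''_def mink_expand pqu)
  then have "B s * u = l * A s" by (simp add: p q A_def algebra_simps power2_eq_square)
  then have u: "u = l / B s * A s" using B0 by (simp add: field_simps)
  have "x = - p *\<^sub>R N s + q *\<^sub>R E1 s + u *\<^sub>R E2 s"
    using pseudo_orthonormal_expand[OF frame[OF s], of x] assms(2) by (simp add: pqu)
  also have "\<dots> = (l / B s) *\<^sub>R W s"
    using B0 by (simp add: W_def p q u scaleR_add_right)
  finally show ?thesis by (rule that)
qed

text \<open>Differentiating \<open>\<langle>\<gamma>, v\<rangle> = c\<close> four times makes \<open>v\<close> orthogonal to \<open>T, T', T'', T'''\<close>. The first three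
identify \<open>v\<close> with a nonzero multiple of \<open>W\<close>.\<close>

lemma hyperplane_imp_obstruction_zero:
  assumes \<gamma>: "\<And>s. s \<in> I \<Longrightarrow> (\<gamma> has_vector_derivative T s) (at s)"
    and v: "v \<noteq> 0" "\<And>s. s \<in> I \<Longrightarrow> mink (\<gamma> s) v = c" and s: "s \<in> I"
  shows "obstruction s = 0"
proof -
  have step: "mink (f' s) v = 0"
    if "\<And>s. s \<in> I \<Longrightarrow> mink (f s) v = c" "\<And>s. s \<in> I \<Longrightarrow> (f has_vector_derivative f' s) (at s)" "s \<in> I"
    for f f' :: "real \<Rightarrow> real^4" and c s
    using mink_const_imp_deriv_zero[OF open_I that(3,1) that(2)[OF that(3)] has_vector_derivative_const]
    by (simp add: mink.zero_right)
  have T0: "mink (T s) v = 0" if "s \<in> I" for s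
    using step[OF v(2) \<gamma> that] .
  have T1: "mink (T' s) v = 0" if "s \<in> I" for s
    using step[OF T0 T_deriv' that] .
  have T2: "mink (T'' s) v = 0" if "s \<in> I" for s
    using step[OF T1 T'_deriv that] .
  have T3: "mink (T''' s) v = 0" if "s \<in> I" for s
    using step[OF T2 T''_deriv that] .
  obtain k where k: "v = k *\<^sub>R W s"
    using perp_imp_multiple_W[OF s, of v] T0[OF s] T1[OF s] T2[OF s] by (auto simp: mink_commute)
  with v(1) have "k \<noteq> 0" by auto
  moreover have "k * obstruction s = 0"
    using T3[OF s] mink_W_T'''[OF s] by (simp add: k mink.scaleR_right mink_commute)
  ultimately show ?thesis by simp
qed

text \<open>Vanishing of \<open>\<rho>\<close> makes \<open>D\<close> orthogonal also to \<open>T'''\<close>, the derivative of \<open>T''\<close>. Differentiating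
\<open>\<langle>D, T\<rangle> = \<langle>D, T'\<rangle> = \<langle>D, T''\<rangle> = 0\<close> then shows that \<open>D'\<close> is orthogonal to \<open>T, T', T''\<close>, hence parallel to
\<open>W\<close> and so to \<open>D\<close>. A unit vector field whose derivative is parallel to it is constant.\<close>

lemma obstruction_zero_imp_constant:
  assumes "is_interval I"
    and D: "\<And>s. s \<in> I \<Longrightarrow> D s = \<mu> s *\<^sub>R W s" "\<And>s. s \<in> I \<Longrightarrow> mink (D s) (D s) = 1"
    and D': "\<And>s. s \<in> I \<Longrightarrow> (D has_vector_derivative D' s) (at s)"
    and zero: "\<And>s. s \<in> I \<Longrightarrow> obstruction s = 0"
  obtains v where "\<And>s. s \<in> I \<Longrightarrow> D s = v"
proof -
  have "D' s = 0" if s: "s \<in> I" for s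
  proof -
    have perp: "mink (D s) (T s) = 0" "mink (D s) (T' s) = 0" "mink (D s) (T'' s) = 0"
        "mink (D s) (T''' s) = 0" if "s \<in> I" for s
      using mink_W_T[OF that] mink_W_T'''[OF that] zero[OF that] by (simp_all add: D(1)[OF that] mink.scaleR_left)
    have "mink (D' s) (T s) = 0" "mink (D' s) (T' s) = 0" "mink (D' s) (T'' s) = 0"
      using mink_const_imp_deriv_zero[OF open_I s perp(1) D'[OF s] T_deriv'[OF s]]
        mink_const_imp_deriv_zero[OF open_I s perp(2) D'[OF s] T'_deriv[OF s]]
        mink_const_imp_deriv_zero[OF open_I s perp(3) D'[OF s] T''_deriv[OF s]] perp[OF s]
      by simp_all
    then obtain k where k: "D' s = k *\<^sub>R W s" using perp_imp_multiple_W[OF s] by blast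
    have "mink (D' s) (D s) = 0"
      using mink_const_imp_deriv_zero[OF open_I s D(2) D'[OF s] D'[OF s]] by (simp add: mink_commute)
    then have "k * (\<mu> s * mink (W s) (W s)) = 0"
      by (auto simp: k D(1)[OF s] mink_expand)
    moreover have "\<mu> s * (\<mu> s * mink (W s) (W s)) = 1"
      using D(2)[OF s] by (simp add: D(1)[OF s] mink_expand)
    ultimately have "k = 0" by auto
    with k show ?thesis by simp
  qed
  then have "\<exists>v. \<forall>s\<in>I. D s = v"
    using has_vector_derivative_zero_constant[of I D] D' assms(1) 
    by (metis has_vector_derivative_at_within is_interval_convex_1)
  with that show ?thesis by blast
qed

lemma constant_imp_hyperplane:
  assumes "is_interval I"
    and \<gamma>: "\<And>s. s \<in> I \<Longrightarrow> (\<gamma> has_vector_derivative T s) (at s)"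
    and D: "\<And>s. s \<in> I \<Longrightarrow> v = \<mu> s *\<^sub>R W s"
  obtains c where "\<And>s. s \<in> I \<Longrightarrow> mink (\<gamma> s) v = c"
proof -
  have "((\<lambda>s. mink (\<gamma> s) v) has_vector_derivative 0) (at s within I)" if "s \<in> I" for s
  proof -
    have "mink (T s) v = 0"
      using mink_W_T(1)[OF that] by (subst D[OF that]) (simp add: mink.scaleR_right mink_commute)
    with mink.has_vector_derivative[OF \<gamma>[OF that] has_vector_derivative_const[of v]]
    show ?thesis by (simp add: mink.zero_right has_vector_derivative_at_within)
  qed
  then have "\<exists>c. \<forall>s\<in>I. mink (\<gamma> s) v = c"
    using has_vector_derivative_zero_constant[of I "\<lambda>s. mink (\<gamma> s) v"] assms(1) 
    by (metis is_interval_convex_1)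
  with that show ?thesis by blast
qed

end

section \<open>The frame of a curve in a spacelike hypersurface\<close>

text \<open>The vector \<open>E = t' - k\<^sub>n n\<close> is orthogonal to the timelike \<open>n\<close>, so \<open>\<langle>E, E\<rangle> \<ge> 0\<close>, and \<open>k\<^sub>g \<noteq> 0\<close> makes it positive.
This settles two points at once: the absolute value in \<open>k\<^sub>g\<close> disappears, so that \<open>k\<^sub>g\<close> is smooth, and
\<open>n\<^sub>1\<close> is spacelike of norm \<open>1\<close>. The structure equations are then the expansions of \<open>n', t', n\<^sub>1', n\<^sub>2'\<close> in
the frame, with coefficients found by differentiating the constant products of the frame vectors.\<close>

lemma darboux_frame_of_curve:
  assumes I: "open I"
    and sm: "smooth_on I \<gamma>" "smooth_on I (n_curve n \<gamma>)"
    and nn: "\<And>s. s \<in> I \<Longrightarrow> mink (n_curve n \<gamma> s) (n_curve n \<gamma> s) = -1"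
    and nt: "\<And>s. s \<in> I \<Longrightarrow> mink (n_curve n \<gamma> s) (tangent \<gamma> s) = 0"
    and tt: "\<And>s. s \<in> I \<Longrightarrow> mink (tangent \<gamma> s) (tangent \<gamma> s) = 1"
    and kg: "\<And>s. s \<in> I \<Longrightarrow> k_g n \<gamma> s \<noteq> 0"
    and kn_kg: "\<And>s. s \<in> I \<Longrightarrow> (k_n n \<gamma> s)\<^sup>2 > (k_g n \<gamma> s)\<^sup>2"
    and nondegenerate: "\<And>s. s \<in> I \<Longrightarrow> k_n n \<gamma> s * tau2 n \<gamma> s + k_g n \<gamma> s * tau_g n \<gamma> s \<noteq> 0"
  shows "darboux_frame I (n_curve n \<gamma>) (tangent \<gamma>) (n1 n \<gamma>) (n2 n \<gamma>)
    (k_n n \<gamma>) (k_g n \<gamma>) (tau1 n \<gamma>) (tau2 n \<gamma>) (tau_g n \<gamma>)"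
proof -
  let ?N = "n_curve n \<gamma>" and ?t = "tangent \<gamma>"
  let ?N' = "\<lambda>s. vector_derivative ?N (at s)" and ?t' = "\<lambda>s. vector_derivative ?t (at s)"
  let ?E = "\<lambda>s. ?t' s - k_n n \<gamma> s *\<^sub>R ?N s"
  have sm_t: "smooth_on I ?t"
    using smooth_on_vector_derivative[OF I sm(1)] by (simp add: tangent_def[abs_def])
  have sm_t': "smooth_on I ?t'" and sm_N': "smooth_on I ?N'"
    by (intro smooth_on_vector_derivative I sm_t sm(2))+
  have sm_kn: "smooth_on I (k_n n \<gamma>)"
    unfolding k_n_def[abs_def] by (intro smooth_on_uminus smooth_on_mink I sm sm_t')
  have sm_E: "smooth_on I ?E"
    by (intro smooth_on_diff smooth_on_scaleR I sm sm_t' sm_kn)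
  note N'=smooth_on_imp_has_vector_derivative[OF sm(2)]
  note t'=smooth_on_imp_has_vector_derivative[OF sm_t]

  have NE: "mink (?N s) (?E s) = 0" if "s \<in> I" for s
    using nn[OF that] by (simp add: mink.add_right mink.diff_right mink.scaleR_right k_n_def)
  have tE: "mink (?t s) (?E s) = 0" if "s \<in> I" for s
    using nt[OF that] mink_const_imp_deriv_zero[OF I that tt t'[OF that] t'[OF that]]
    by (simp add: mink.diff_right mink.scaleR_right mink_commute)
  have EE: "mink (?E s) (?E s) > 0" if "s \<in> I" for s
    using mink_perp_timelike_nonneg[OF _ NE[OF that]] nn[OF that] kg[OF that]
    by (auto simp: k_g_def mnorm_def order_less_le)
  have kg_E: "k_g n \<gamma> s = sqrt (mink (?E s) (?E s))" if "s \<in> I" for s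
    using EE[OF that] by (simp add: k_g_def mnorm_def)
  have kg_pos: "k_g n \<gamma> s > 0" if "s \<in> I" for s
    using EE[OF that] by (simp add: kg_E[OF that])
  have sm_kg: "smooth_on I (k_g n \<gamma>)"
    by (rule smooth_on_cong[OF I kg_E[symmetric]]) (auto intro!: smooth_on_sqrt smooth_on_mink I sm_E EE)
  have sm_n1: "smooth_on I (n1 n \<gamma>)"
    unfolding n1_def[abs_def] divide_inverse
    by (intro smooth_on_scaleR smooth_on_mult smooth_on_inverse smooth_on_const I sm_kg sm_E kg_pos)
  have sm_n2: "smooth_on I (n2 n \<gamma>)"
    unfolding n2_def[abs_def] by (intro smooth_on_wedge I sm sm_t sm_n1)
  have sm_n2': "smooth_on I (\<lambda>s. vector_derivative (n2 n \<gamma>) (at s))"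
    by (intro smooth_on_vector_derivative I sm_n2)
  have sm_tau: "smooth_on I (tau1 n \<gamma>)" "smooth_on I (tau2 n \<gamma>)" "smooth_on I (tau_g n \<gamma>)"
    unfolding tau1_def[abs_def] tau2_def[abs_def] tau_g_def[abs_def]
    by (intro smooth_on_mink smooth_on_uminus I sm_n1 sm_n2 sm_N' sm_n2')+
  note n1'=smooth_on_imp_has_vector_derivative[OF sm_n1]
  note n2'=smooth_on_imp_has_vector_derivative[OF sm_n2]

  have frame: "pseudo_orthonormal (?N s) (?t s) (n1 n \<gamma> s) (n2 n \<gamma> s)" if "s \<in> I" for s
    unfolding n2_def
  proof (rule pseudo_orthonormal_wedge[OF nn[OF that] tt[OF that] _ nt[OF that]])
    show "mink (n1 n \<gamma> s) (n1 n \<gamma> s) = 1"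
      using EE[OF that] kg_E[OF that] kg_pos[OF that]
      by (simp add: n1_def mink.scaleR_left mink.scaleR_right)
    show "mink (?N s) (n1 n \<gamma> s) = 0" "mink (?t s) (n1 n \<gamma> s) = 0"
      using NE[OF that] tE[OF that] by (simp_all add: n1_def mink.scaleR_right)
  qed
  note fm = pseudo_orthonormal_mink[OF frame]
  have t'_eq: "?t' s = k_n n \<gamma> s *\<^sub>R ?N s + k_g n \<gamma> s *\<^sub>R n1 n \<gamma> s" if "s \<in> I" for s
    using kg[OF that] by (simp add: n1_def)
  have N'_eq: "?N' s = k_n n \<gamma> s *\<^sub>R ?t s + tau1 n \<gamma> s *\<^sub>R n1 n \<gamma> s + tau2 n \<gamma> s *\<^sub>R n2 n \<gamma> s"
    if s: "s \<in> I" for s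
  proof -
    have "mink (?N' s) (?N s) = 0" "mink (?N' s) (?t s) = k_n n \<gamma> s"
      using mink_const_imp_deriv_zero[OF I s nn N'[OF s] N'[OF s]]
        mink_const_imp_deriv_zero[OF I s nt N'[OF s] t'[OF s]]
      by (simp_all add: k_n_def mink_commute)
    then show ?thesis
      by (subst pseudo_orthonormal_expand[OF frame[OF s], of "?N' s"])
        (simp add: tau1_def tau2_def mink_commute)
  qed
  have n1'_eq: "vector_derivative (n1 n \<gamma>) (at s) =
      tau1 n \<gamma> s *\<^sub>R ?N s - k_g n \<gamma> s *\<^sub>R ?t s + tau_g n \<gamma> s *\<^sub>R n2 n \<gamma> s" (is "?D = _")
    if s: "s \<in> I" for s
  proof -
    have "mink ?D (?N s) = - tau1 n \<gamma> s" "mink ?D (?t s) = - k_g n \<gamma> s"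
      "mink ?D (n1 n \<gamma> s) = 0" "mink ?D (n2 n \<gamma> s) = tau_g n \<gamma> s"
      using mink_const_imp_deriv_zero[OF I s fm(12) n1'[OF s] N'[OF s]]
        mink_const_imp_deriv_zero[OF I s fm(14) n1'[OF s] t'[OF s]]
        mink_const_imp_deriv_zero[OF I s fm(3) n1'[OF s] n1'[OF s]]
        mink_const_imp_deriv_zero[OF I s fm(10) n1'[OF s] n2'[OF s]] fm[OF s]
      by (simp_all add: tau1_def tau_g_def t'_eq[OF s] mink.add_right mink.scaleR_right mink_commute[of ?D])
        (simp_all add: mink_commute)
    then show ?thesis
      by (subst pseudo_orthonormal_expand[OF frame[OF s], of ?D]) simp
  qed
  have n2'_eq: "vector_derivative (n2 n \<gamma>) (at s) = tau2 n \<gamma> s *\<^sub>R ?N s - tau_g n \<gamma> s *\<^sub>R n1 n \<gamma> s"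
     (is "?D = _")
    if s: "s \<in> I" for s
  proof -
    have "mink ?D (?N s) = - tau2 n \<gamma> s" "mink ?D (?t s) = 0"
      "mink ?D (n1 n \<gamma> s) = - tau_g n \<gamma> s" "mink ?D (n2 n \<gamma> s) = 0"
      using mink_const_imp_deriv_zero[OF I s fm(13) n2'[OF s] N'[OF s]]
        mink_const_imp_deriv_zero[OF I s fm(15) n2'[OF s] t'[OF s]]
        mink_const_imp_deriv_zero[OF I s fm(4) n2'[OF s] n2'[OF s]] fm[OF s]
      by (simp_all add: tau2_def tau_g_def t'_eq[OF s] mink.add_right mink.scaleR_right mink_commute[of ?D])
    then show ?thesis
      by (subst pseudo_orthonormal_expand[OF frame[OF s], of ?D]) simp
  qed
  show ?thesis
  proof unfold_locales
    fix s assume s: "s \<in> I"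
    from N'[OF s] show "(?N has_vector_derivative k_n n \<gamma> s *\<^sub>R ?t s + tau1 n \<gamma> s *\<^sub>R n1 n \<gamma> s
        + tau2 n \<gamma> s *\<^sub>R n2 n \<gamma> s) (at s)" by (simp only: N'_eq[OF s])
    from t'[OF s] show "(?t has_vector_derivative k_n n \<gamma> s *\<^sub>R ?N s + k_g n \<gamma> s *\<^sub>R n1 n \<gamma> s) (at s)"
      by (simp only: t'_eq[OF s])
    from n1'[OF s] show "(n1 n \<gamma> has_vector_derivative tau1 n \<gamma> s *\<^sub>R ?N s - k_g n \<gamma> s *\<^sub>R ?t s
        + tau_g n \<gamma> s *\<^sub>R n2 n \<gamma> s) (at s)" by (simp only: n1'_eq[OF s])
    from n2'[OF s] show "(n2 n \<gamma> has_vector_derivative tau2 n \<gamma> s *\<^sub>R ?N s - tau_g n \<gamma> s *\<^sub>R n1 n \<gamma> s) (at s)"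
      by (simp only: n2'_eq[OF s])
  qed (use I frame sm_kn sm_kg sm_tau kn_kg nondegenerate in auto)
qed

text \<open>By the chain rule the velocity of \<open>\<gamma>\<close> is a tangent vector \<open>dX(\<dots>)\<close> of the hypersurface, so it is orthogonal to
the normal field and spacelike; unit speed alone would only give \<open>\<langle>t, t\<rangle> = \<plusminus>1\<close>.\<close>

lemma curve_in_hypersurface:
  assumes X: "spacelike_embedding U X" and n: "future_unit_normal U X n"
    and I: "open I" and g: "regular_curve_on I g" "g ` I \<subseteq> U"
    and \<gamma>: "\<gamma> = X \<circ> g" "unit_speed_on I \<gamma>"
  shows "smooth_on I \<gamma>" "smooth_on I (n_curve n \<gamma>)"
    and "s \<in> I \<Longrightarrow> mink (n_curve n \<gamma> s) (n_curve n \<gamma> s) = -1"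
    and "s \<in> I \<Longrightarrow> mink (n_curve n \<gamma> s) (tangent \<gamma> s) = 0"
    and "s \<in> I \<Longrightarrow> mink (tangent \<gamma> s) (tangent \<gamma> s) = 1"
proof -
  have smX: "smooth_on U X" and smg: "smooth_on I g" and smn: "smooth_on U (n \<circ> X)"
    using X g n by (auto simp: spacelike_embedding_def smooth_embedding_def regular_curve_on_def future_unit_normal_def)
  show "smooth_on I \<gamma>"
    using smooth_on_compose[OF I g(2) smX smg] by (simp add: \<gamma> comp_def)
  show "smooth_on I (n_curve n \<gamma>)"
    using smooth_on_compose[OF I g(2) smn smg] by (simp add: \<gamma> comp_def n_curve_def[abs_def])
  assume s: "s \<in> I"
  then have gs: "g s \<in> U" using g(2) by blast
  have "Ck_on (Suc 0) U X" using smX unfolding smooth_on_def by blast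
  then have DX: "(X has_derivative frechet_derivative X (at (g s))) (at (g s))"
    using Ck_on_SucD(1) gs by blast
  have "(\<gamma> has_vector_derivative frechet_derivative X (at (g s)) (vector_derivative g (at s))) (at s)"
    using has_derivative_compose[OF smooth_on_imp_has_vector_derivative[OF smg s, unfolded has_vector_derivative_def] DX]
      linear_cmul[OF has_derivative_linear[OF DX]]
    by (simp add: has_vector_derivative_def \<gamma> comp_def)
  then have t: "tangent \<gamma> s = frechet_derivative X (at (g s)) (vector_derivative g (at s))"
    by (simp add: tangent_def vector_derivative_at)
  show "mink (n_curve n \<gamma> s) (n_curve n \<gamma> s) = -1"
    using n gs by (auto simp: future_unit_normal_def timelike_def mnorm_def n_curve_def \<gamma>)
  show "mink (n_curve n \<gamma> s) (tangent \<gamma> s) = 0"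
    unfolding t n_curve_def using n gs by (simp add: future_unit_normal_def \<gamma>(1))
  have unit: "sqrt \<bar>mink (tangent \<gamma> s) (tangent \<gamma> s)\<bar> = 1"
    using \<gamma>(2) s by (simp add: unit_speed_on_def mnorm_def tangent_def)
  then have "tangent \<gamma> s \<noteq> 0" by (auto simp: mink.zero_left)
  then have "mink (tangent \<gamma> s) (tangent \<gamma> s) > 0"
    using X gs unfolding spacelike_embedding_def spacelike_def t by blast
  with unit show "mink (tangent \<gamma> s) (tangent \<gamma> s) = 1" by simp
qed

section \<open>Constancy of the singular direction\<close>

theorem proposition5p6:
  fixes U :: "(real^3) set" and X :: "real^3 \<Rightarrow> real^4" and n :: "real^4 \<Rightarrow> real^4"
    and I :: "real set" and \<gamma>bar :: "real \<Rightarrow> real^3" and \<gamma> :: "real \<Rightarrow> real^4"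
    and \<theta> :: "real \<Rightarrow> real" and M :: "(real^4) set"
  assumes X: "spacelike_embedding U X"
    and M: "M = X ` U"
    and n: "future_unit_normal U X n"
    and I: "open I" "is_interval I" "I \<noteq> {}"
    and \<gamma>bar: "regular_curve_on I \<gamma>bar" "\<gamma>bar ` I \<subseteq> U"
    and \<gamma>: "\<gamma> = X \<circ> \<gamma>bar" "unit_speed_on I \<gamma>"
    and kg: "\<forall>s\<in>I. k_g n \<gamma> s \<noteq> 0"
    and nondegenerate: "\<forall>s\<in>I. k_n n \<gamma> s * tau2 n \<gamma> s + k_g n \<gamma> s * tau_g n \<gamma> s \<noteq> 0"
    and kn_kg: "\<forall>s\<in>I. (k_n n \<gamma> s)\<^sup>2 > (k_g n \<gamma> s)\<^sup>2"
    and \<theta>_smooth: "smooth_on I \<theta>"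
    and singular: "\<forall>s\<in>I. singular_at (DS n \<gamma>) s (\<theta> s)"
    and tan_\<theta>: "\<forall>s\<in>I. cos (\<theta> s) \<noteq> 0 \<and> tan (\<theta> s) =
        (k_g n \<gamma> s * deriv (k_n n \<gamma>) s + (k_g n \<gamma> s)\<^sup>2 * tau1 n \<gamma> s
           - (k_n n \<gamma> s)\<^sup>2 * tau1 n \<gamma> s - k_n n \<gamma> s * deriv (k_g n \<gamma>) s)
        / (sqrt ((k_n n \<gamma> s)\<^sup>2 - (k_g n \<gamma> s)\<^sup>2)
           * (k_n n \<gamma> s * tau2 n \<gamma> s + k_g n \<gamma> s * tau_g n \<gamma> s))"
  shows "((\<exists>v. spacelike v \<and> (\<forall>s\<in>I. DS n \<gamma> s (\<theta> s) = v)) \<longleftrightarrow> (\<forall>s\<in>I. rho n \<gamma> s = 0))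
    \<and> ((\<forall>s\<in>I. rho n \<gamma> s = 0) \<longleftrightarrow> (\<exists>v c. spacelike v \<and> \<gamma> ` I \<subseteq> M \<inter> HP v c))"
proof -
  note curve = curve_in_hypersurface[OF X n I(1) \<gamma>bar \<gamma>]
  interpret F: darboux_frame I "n_curve n \<gamma>" "tangent \<gamma>" "n1 n \<gamma>" "n2 n \<gamma>"
      "k_n n \<gamma>" "k_g n \<gamma>" "tau1 n \<gamma>" "tau2 n \<gamma>" "tau_g n \<gamma>"
    using darboux_frame_of_curve[OF I(1) curve] kg kn_kg nondegenerate by blast
  have \<gamma>': "(\<gamma> has_vector_derivative tangent \<gamma> s) (at s)" if "s \<in> I" for s
    using smooth_on_imp_has_vector_derivative[OF curve(1) that] by (simp add: tangent_def)
  have rho: "rho n \<gamma> s = F.obstruction s" for s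
    by (simp add: rho_def F.obstruction_def Let_def)
  define D where "D s = DS n \<gamma> s (\<theta> s)" for s
  define r where "r s = sqrt ((k_n n \<gamma> s)\<^sup>2 - (k_g n \<gamma> s)\<^sup>2)" for s
  have r: "r s > 0" if "s \<in> I" for s
    using kn_kg that by (simp add: r_def)
  define \<mu> where "\<mu> s = cos (\<theta> s) / (r s * F.B s)" for s
  have D_W: "D s = \<mu> s *\<^sub>R F.W s" if s: "s \<in> I" for s
  proof -
    have B: "F.B s \<noteq> 0" using nondegenerate s by (simp add: F.B_def)
    \<comment> \<open>The denominator \<open>r B\<close> of \<open>tan \<theta>\<close> is absorbed into \<open>\<mu>\<close>, which leaves the coefficient \<open>A\<close> of \<open>n\<^sub>2\<close>.\<close>
    have "cos (\<theta> s) \<noteq> 0" "tan (\<theta> s) = F.A s / (r s * F.B s)"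
      using tan_\<theta> s by (auto simp: F.A_def F.B_def r_def)
    then have "sin (\<theta> s) = \<mu> s * F.A s"
      by (simp add: \<mu>_def tan_def field_simps)
    then show ?thesis
      using B by (simp add: D_def DS_def F.W_def \<mu>_def scaleR_add_right flip: r_def)
  qed
  have D_unit: "mink (D s) (D s) = 1" if s: "s \<in> I" for s
  proof -
    have D_eq: "D s = (cos (\<theta> s) / r s) *\<^sub>R (k_g n \<gamma> s *\<^sub>R n_curve n \<gamma> s + k_n n \<gamma> s *\<^sub>R n1 n \<gamma> s)
        + sin (\<theta> s) *\<^sub>R n2 n \<gamma> s"
      by (simp add: D_def DS_def r_def)
    have "mink (D s) (D s) = (cos (\<theta> s) / r s)\<^sup>2 * ((k_n n \<gamma> s)\<^sup>2 - (k_g n \<gamma> s)\<^sup>2) + (sin (\<theta> s))\<^sup>2"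
      using F.frame_mink[OF s]
      by (simp add: D_eq F.mink_expand algebra_simps power2_eq_square)
    also have "(k_n n \<gamma> s)\<^sup>2 - (k_g n \<gamma> s)\<^sup>2 = (r s)\<^sup>2"
      using r[OF s] by (simp add: r_def)
    finally show ?thesis using r[OF s] by (simp add: power_divide)
  qed
  \<comment> \<open>Only the existence of \<open>D'\<close> matters; its value is left to unification with the differentiation rules.\<close>
  have D': "\<exists>d. (D has_vector_derivative d) (at s)" if s: "s \<in> I" for s
  proof -
    have pos: "(k_n n \<gamma> s)\<^sup>2 - (k_g n \<gamma> s)\<^sup>2 > 0" using kn_kg s by simp
    show ?thesis
      unfolding D_def DS_def
      by (rule exI, (rule derivative_eq_intros refl F.scalar_deriv F.N_deriv F.E1_deriv F.E2_deriv
          smooth_on_imp_DERIV[OF \<theta>_smooth] s pos | (use pos in simp; fail))+)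
  qed
  have 12: "\<exists>v. spacelike v \<and> (\<forall>s\<in>I. D s = v)" if zero: "\<forall>s\<in>I. rho n \<gamma> s = 0"
  proof -
    obtain v where v: "\<And>s. s \<in> I \<Longrightarrow> D s = v"
      using F.obstruction_zero_imp_constant[OF I(2) D_W D_unit _ ] D' zero rho by metis
    obtain s where "s \<in> I" using I(3) by blast
    with D_unit v have "mink v v = 1" by metis
    then have "spacelike v" by (auto simp: spacelike_def mink.zero_left)
    with v show ?thesis by blast
  qed
  have 23: "\<exists>v c. spacelike v \<and> \<gamma> ` I \<subseteq> M \<inter> HP v c" if v: "spacelike v" "\<forall>s\<in>I. D s = v" for v
  proof -
    obtain c where "\<And>s. s \<in> I \<Longrightarrow> mink (\<gamma> s) v = c"
      using F.constant_imp_hyperplane[OF I(2) \<gamma>', of v \<mu>] D_W v(2) by metis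
    then have "\<gamma> ` I \<subseteq> M \<inter> HP v c" using \<gamma>bar(2) by (auto simp: HP_def M \<gamma>(1))
    with v(1) show ?thesis by blast
  qed
  have 31: "\<forall>s\<in>I. rho n \<gamma> s = 0" if v: "spacelike v" "\<gamma> ` I \<subseteq> M \<inter> HP v c" for v c
  proof
    have "v \<noteq> 0" using v(1) by (simp add: spacelike_def)
    moreover have "mink (\<gamma> s) v = c" if "s \<in> I" for s
      using v(2) that by (auto simp: HP_def)
    moreover fix s assume "s \<in> I"
    ultimately show "rho n \<gamma> s = 0"
      unfolding rho using F.hyperplane_imp_obstruction_zero[of \<gamma> v c s] \<gamma>' by blast
  qed
  show ?thesis using 12 23 31 unfolding D_def by blast
qed

end
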